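(* Let $D$ be a strong balanced bipartite digraph of order $2a$, where $a\ge 3$. If $D$ satisfies the condition $M_{-1}$, i.e. $d(u)+d(v)\ge 3a-1$ for all pairs of non-adjacent vertices $u,v$ of $D$, then $D$ is traceable.
   Context: Digraphs are finite, without loops and without multiple arcs (the two opposite arcs $xy$ and $yx$ may both be present). $V(D)$ and $A(D)$ denote the vertex set and arc set. $d(v)=d^+(v)+d^-(v)$ is the sum of the out-degree and the in-degree of $v$ in $D$. Two distinct vertices $u,v$ are non-adjacent if $uv\notin A(D)$ and $vu\notin A(D)$; in particular, two distinct vertices in the same partite set of a bipartite digraph are non-adjacent. $D$ is strong if for every ordered pair of vertices $x,y$ there is a directed path from $x$ to $y$. $D$ is bipartite if $V(D)$ is the disjoint union of two independent sets $V_1,V_2$ (the partite sets), and balanced if $|V_1|=|V_2|$. $D$ is traceable if it possesses a hamiltonian path, i.e. a directed path containing every vertex of $D$. *)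

theory Defs
  imports "Graph_Theory.Graph_Theory"
begin

definition total_degree :: "('a, 'b) pre_digraph \<Rightarrow> 'a \<Rightarrow> nat" where
  "total_degree D v = out_degree D v + in_degree D v"

definition nonadjacent :: "('a, 'b) pre_digraph \<Rightarrow> 'a \<Rightarrow> 'a \<Rightarrow> bool" where
  "nonadjacent D u v \<longleftrightarrow>
     u \<in> verts D \<and> v \<in> verts D \<and> u \<noteq> v \<and> \<not> u \<rightarrow>\<^bsub>D\<^esub> v \<and> \<not> v \<rightarrow>\<^bsub>D\<^esub> u"

definition independent_set :: "('a, 'b) pre_digraph \<Rightarrow> 'a set \<Rightarrow> bool" where
  "independent_set D S \<longleftrightarrow> S \<subseteq> verts D \<and> (\<forall>u \<in> S. \<forall>v \<in> S. \<not> u \<rightarrow>\<^bsub>D\<^esub> v)"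

definition bipartition :: "('a, 'b) pre_digraph \<Rightarrow> 'a set \<Rightarrow> 'a set \<Rightarrow> bool" where
  "bipartition D V1 V2 \<longleftrightarrow>
     verts D = V1 \<union> V2 \<and> V1 \<inter> V2 = {} \<and> independent_set D V1 \<and> independent_set D V2"

definition balanced_bipartite :: "('a, 'b) pre_digraph \<Rightarrow> bool" where
  "balanced_bipartite D \<longleftrightarrow> (\<exists>V1 V2. bipartition D V1 V2 \<and> card V1 = card V2)"

definition hamiltonian_path :: "('a, 'b) pre_digraph \<Rightarrow> 'a vwalk \<Rightarrow> bool" where
  "hamiltonian_path D p \<longleftrightarrow> vpath p D \<and> set p = verts D"

definition traceable :: "('a, 'b) pre_digraph \<Rightarrow> bool" where
  "traceable D \<longleftrightarrow> (\<exists>p. hamiltonian_path D p)"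

end

theory Submission
  imports Defs "HOL-Combinatorics.Orbits"
begin

text \<open>
  Write $d^+$ and $d^-$ for out- and in-degree and $d = d^+ + d^-$. A hamiltonian path of a bipartite
  digraph with parts of equal size $a$ is the same thing as a permutation $\sigma$ of the vertices
  that exchanges the two parts, has a single orbit, and satisfies $v \to \sigma v$ for all vertices
  $v$ except possibly one, the gap. Everything is done with such part-exchanging permutations and
  one operation on them: composing $\sigma$ with the transposition of two vertices $u, v$ of the same
  part, which replaces the pairs $(u, \sigma u), (v, \sigma v)$ by $(u, \sigma v), (v, \sigma u)$.
  Whenever an exchange is forbidden by an extremal choice of $\sigma$, at least one of the arcs
  $u \to \sigma v$, $v \to \sigma u$ is absent; summing these absences over many pairs
  bounds degree sums from above, and the degree condition bounds them from below.

  The first extremal choice minimises the number of defects, i.e. of $u$ with $u \not\to \sigma u$.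
  For a defect $u$ it gives $d^+(u) + d^-(\sigma u) \le a - 1$, and two defects in the same part would
  give two such inequalities with right-hand side $a - 2$, which is too small for the degree condition
  (\<open>defect_same_part_unique\<close>). Exchanges with a good pair move the defect without changing
  the number of defects, so the inequalities hold for all the resulting defects as well; comparing them
  forces $d^-(u) = a$ and $d^+(u) = (a-1)/2$ (\<open>defect_degrees\<close>). A defect $w$ in the other part
  then would have more than $(a-1)/2$ out-neighbours. Hence there is at most one defect
  (\<open>defect_unique\<close>).

  The second extremal choice is among the pairs of a permutation $\sigma$ and a vertex $b$ such that
  all defects are at $b$: it maximises the orbit $P$ of $b$. Suppose that $P$ misses a nonempty set $C$,
  and let $|P| = 2r$, $|C| = 2k$. Since the digraph is strong, $b \not\to \sigma b$. No exchange
  between $C$ and $P$ can be allowed, since it would enlarge $P$; at $b$ itself even one of the two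
  new arcs would suffice. So there are at most $k(2r - 1)$ arcs between $C$ and $P$
  (\<open>cut_le\<close>), and $r \ge 2$ because $b$ has an out-neighbour. If $k \ge 2$, the degree
  condition summed over $C$ gives $r \le k$ and summed over $P$ gives $k < r$. If $k = 1$, the two
  vertices of $C$ have degree sum at most $2a + 1$, whereas $b$ and $\sigma b$ both miss two arcs, so
  that pairing these four vertices by parts violates the degree condition. Hence $P$ is everything,
  and running along it from $\sigma b$ to $b$ is a hamiltonian path.
\<close>
section \<open>Averaging over pairs, and merging two orbits\<close>

text \<open>Averaging over all ordered pairs: each element occurs in \<open>2 * (card A - 1)\<close> of them.\<close>
lemma double_sum_ge_of_pairwise:
  fixes d :: "'a \<Rightarrow> int"
  assumes "finite A" "card A \<ge> 2"
    and pair: "\<And>u v. u \<in> A \<Longrightarrow> v \<in> A \<Longrightarrow> u \<noteq> v \<Longrightarrow> s \<le> d u + d v"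
  shows "int (card A) * s \<le> 2 * sum d A"
proof -
  let ?n = "int (card A)"
  have n1: "int (card A - Suc 0) = ?n - 1" using assms(2) by linarith
  have "(\<Sum>u\<in>A. \<Sum>v\<in>A - {u}. s) \<le> (\<Sum>u\<in>A. \<Sum>v\<in>A - {u}. d u + d v)"
    by (intro sum_mono pair) auto
  moreover have "(\<Sum>u\<in>A. \<Sum>v\<in>A - {u}. s) = (?n - 1) * (?n * s)"
    using assms(1) by (simp add: n1 algebra_simps)
  moreover have "(\<Sum>u\<in>A. \<Sum>v\<in>A - {u}. d u + d v) = (?n - 1) * (2 * sum d A)"
  proof -
    have "(\<Sum>u\<in>A. \<Sum>v\<in>A - {u}. d u + d v) = (\<Sum>u\<in>A. (?n - 2) * d u + sum d A)"
      using assms(1,2)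
      by (intro sum.cong) (auto simp: sum.distrib sum_diff1 card_Diff_singleton of_nat_diff algebra_simps)
    also have "\<dots> = (?n - 2) * sum d A + ?n * sum d A"
      by (simp add: sum.distrib sum_distrib_left)
    finally show ?thesis by (simp add: algebra_simps)
  qed
  ultimately have "(?n - 1) * (?n * s) \<le> (?n - 1) * (2 * sum d A)" by (simp only:)
  moreover have "?n - 1 > 0" using assms(2) by linarith
  ultimately show ?thesis by (simp only: mult_le_cancel_left_pos)
qed

lemma sum_of_bool_mem:
  assumes "finite S" "N \<subseteq> S"
  shows "(\<Sum>z\<in>S. of_bool (z \<in> N)) = int (card N)"
  using assms by (simp add: Int_absorb1)

text \<open>
  Exchanging the images of two points in different orbits splices the two cycles into one. Starting
  from \<open>v\<close>, the new permutation first runs through the old orbit of \<open>u\<close>, ending in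
  \<open>u\<close>, and then through the old orbit of \<open>v\<close>.
\<close>
lemma orbit_comp_transpose_merge:
  assumes "permutation \<sigma>" "v \<in> orbit \<sigma> b" "u \<notin> orbit \<sigma> b"
  shows "insert u (orbit \<sigma> b) \<subseteq> orbit (\<sigma> \<circ> transpose u v) v"
proof -
  let ?\<tau> = "\<sigma> \<circ> transpose u v"
  have Pv: "orbit \<sigma> v = orbit \<sigma> b"
    by (intro orbit_cyclic_eq3[OF cyclic_on_orbit'[OF assms(1)] assms(2)])
  have uu: "u \<in> orbit \<sigma> u" by (rule permutation_self_in_orbit[OF assms(1)])
  have v_notin: "v \<notin> orbit \<sigma> u"
    using assms(3) Pv orbit_swap[OF uu] by blast
  have tv: "?\<tau> v = \<sigma> u" and tu': "?\<tau> u = \<sigma> v" by simp_all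
  have O1: "w \<in> orbit ?\<tau> v" if "w \<in> orbit \<sigma> u" for w
    using that
  proof induction
    case base
    show ?case using orbit.base[of ?\<tau> v] by (simp only: tv)
  next
    case (step w)
    show ?case
    proof (cases "w = u")
      case True
      then show ?thesis using orbit.base[of ?\<tau> v] by (simp only: tv)
    next
      case False
      moreover have "w \<noteq> v" using step.hyps v_notin by auto
      ultimately have "?\<tau> w = \<sigma> w" by (simp add: transpose_def)
      then show ?thesis using orbit.step[OF step.IH] by (simp only:)
    qed
  qed
  from O1[OF uu] have tu: "u \<in> orbit ?\<tau> v" .
  have sv: "\<sigma> v \<in> orbit ?\<tau> v" using orbit.step[OF tu] by (simp only: tu')
  have "w \<in> orbit ?\<tau> v" if "w \<in> orbit \<sigma> v" for w
    using that
  proof induction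
    case base
    show ?case by (rule sv)
  next
    case (step w)
    show ?case
    proof (cases "w = v")
      case True
      then show ?thesis using sv by (simp only:)
    next
      case False
      moreover have "w \<noteq> u" using step.hyps Pv assms(3) by auto
      ultimately have "?\<tau> w = \<sigma> w" by (simp add: transpose_def)
      then show ?thesis using orbit.step[OF step.IH] by (simp only:)
    qed
  qed
  with tu Pv show ?thesis by auto
qed

section \<open>Bipartite relations and part-swapping permutations\<close>

definition outdeg :: "('a \<Rightarrow> 'a \<Rightarrow> bool) \<Rightarrow> 'a set \<Rightarrow> 'a \<Rightarrow> int" where
  "outdeg E V u = (\<Sum>w\<in>V. of_bool (E u w))"

definition indeg :: "('a \<Rightarrow> 'a \<Rightarrow> bool) \<Rightarrow> 'a set \<Rightarrow> 'a \<Rightarrow> int" where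
  "indeg E V u = (\<Sum>w\<in>V. of_bool (E w u))"

text \<open>
  The hypotheses on the digraph, expressed for its adjacency relation. Degrees are integers so that
  they can be subtracted, and strong connectivity is given in its cut form. The second part is
  \<open>V - X\<close>, and "being in the same part" is the equivalence \<open>u \<in> X \<longleftrightarrow> v \<in> X\<close>; this keeps
  every argument symmetric in the two parts.
\<close>
locale strong_bipartite =
  fixes E :: "'a \<Rightarrow> 'a \<Rightarrow> bool" and V X :: "'a set" and a :: nat
  assumes finite_V: "finite V"
    and X_sub: "X \<subseteq> V"
    and card_X: "card X = a"
    and card_Y: "card (V - X) = a"
    and two_le_a: "a \<ge> 2"
    and E_cross: "E u v \<Longrightarrow> u \<in> V \<and> v \<in> V \<and> (u \<in> X \<longleftrightarrow> v \<notin> X)"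
    and leave: "S \<subseteq> V \<Longrightarrow> S \<noteq> {} \<Longrightarrow> S \<noteq> V \<Longrightarrow> \<exists>u\<in>S. \<exists>v\<in>V - S. E u v"
    and degree_sum: "u \<in> V \<Longrightarrow> v \<in> V \<Longrightarrow> u \<noteq> v \<Longrightarrow> (u \<in> X \<longleftrightarrow> v \<in> X) \<Longrightarrow>
      3 * int a - 1 \<le> outdeg E V u + indeg E V u + (outdeg E V v + indeg E V v)"
begin

abbreviation dout :: "'a \<Rightarrow> int" where "dout \<equiv> outdeg E V"
abbreviation din :: "'a \<Rightarrow> int" where "din \<equiv> indeg E V"
abbreviation e :: "'a \<Rightarrow> 'a \<Rightarrow> int" where "e u v \<equiv> of_bool (E u v)"
abbreviation same :: "'a \<Rightarrow> 'a \<Rightarrow> bool" where "same u v \<equiv> (u \<in> X \<longleftrightarrow> v \<in> X)"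

lemma degree_altdef: "dout u + din u = (\<Sum>w\<in>V. e u w + e w u)"
  by (simp add: outdeg_def indeg_def sum.distrib)

lemma card_part:
  assumes "S \<subseteq> V" "card (S \<inter> X) = n" "card (S - X) = n"
  shows "card {w \<in> S. same u w} = n" "card {w \<in> S. \<not> same u w} = n"
proof -
  have "{w \<in> S. w \<in> X} = S \<inter> X" "{w \<in> S. w \<notin> X} = S - X" by auto
  then show "card {w \<in> S. same u w} = n" "card {w \<in> S. \<not> same u w} = n"
    using assms by (cases "u \<in> X"; simp)+
qed

lemma card_V_part: "card {w \<in> V. same u w} = a" "card {w \<in> V. \<not> same u w} = a"
  using card_part[of V a u] X_sub card_X card_Y by (simp_all add: Int_absorb1)

lemma degree_into_le:
  assumes "S \<subseteq> V" "card {w \<in> S. \<not> same u w} = n"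
  shows "(\<Sum>w\<in>S. e u w) \<le> int n" "(\<Sum>w\<in>S. e w u) \<le> int n"
proof -
  have fS: "finite S" using assms finite_V finite_subset by blast
  have *: "(\<Sum>w\<in>S. of_bool (\<not> same u w)) = int n"
    using assms fS by (simp add: Int_def)
  have "(\<Sum>w\<in>S. e u w) \<le> (\<Sum>w\<in>S. of_bool (\<not> same u w))"
    using E_cross by (intro sum_mono) auto
  with * show "(\<Sum>w\<in>S. e u w) \<le> int n" by simp
  have "(\<Sum>w\<in>S. e w u) \<le> (\<Sum>w\<in>S. of_bool (\<not> same u w))"
    using E_cross by (intro sum_mono) auto
  with * show "(\<Sum>w\<in>S. e w u) \<le> int n" by simp
qed

lemma dout_le: "dout u \<le> int a" and din_le: "din u \<le> int a"
  using degree_into_le[OF order.refl card_V_part(2)] by (simp_all add: outdeg_def indeg_def)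

text \<open>
  The average is taken in \<open>S \<inter> X\<close> and in \<open>S - X\<close> separately, so each of them has to contain a pair of
  vertices for the degree condition to say anything.
\<close>
lemma degree_sum_ge:
  assumes "S \<subseteq> V" "card (S \<inter> X) = n" "card (S - X) = n" "n \<ge> 2"
  shows "int n * (3 * int a - 1) \<le> (\<Sum>u\<in>S. dout u + din u)"
proof -
  have fS: "finite S" using assms finite_V finite_subset by blast
  have part: "int n * (3 * int a - 1) \<le> 2 * (\<Sum>u\<in>A. dout u + din u)"
    if A: "A \<subseteq> S" "card A = n" and same: "\<And>u v. u \<in> A \<Longrightarrow> v \<in> A \<Longrightarrow> same u v" for A
    unfolding A(2)[symmetric]
  proof (rule double_sum_ge_of_pairwise)
    show "finite A" using A(1) fS by (rule finite_subset)
    show "card A \<ge> 2" using A(2) assms(4) by simp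
    show "3 * int a - 1 \<le> dout u + din u + (dout v + din v)" if "u \<in> A" "v \<in> A" "u \<noteq> v" for u v
      using that A(1) assms(1) same[of u v] by (intro degree_sum) auto
  qed
  have "int n * (3 * int a - 1) \<le> 2 * (\<Sum>u\<in>S \<inter> X. dout u + din u)"
    using assms(2) by (intro part) auto
  moreover have "int n * (3 * int a - 1) \<le> 2 * (\<Sum>u\<in>S - X. dout u + din u)"
    using assms(3) by (intro part) auto
  moreover have "(\<Sum>u\<in>S. dout u + din u) = (\<Sum>u\<in>S \<inter> X. dout u + din u) + (\<Sum>u\<in>S - X. dout u + din u)"
    by (rule sum.Int_Diff[OF fS])
  ultimately show ?thesis by linarith
qed

lemma two_missing_arcs:
  assumes "w \<in> V" "x \<in> V" "y \<in> V" "x \<noteq> y" "\<not> same w x" "\<not> same w y"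
    and "\<not> E w x \<and> \<not> E w y \<or> \<not> E x w \<and> \<not> E y w"
  shows "dout w + din w \<le> 2 * int a - 2"
proof -
  let ?N = "{z \<in> V. \<not> same w z} - {x, y}"
  have "card ?N = a - 2"
    using assms finite_V by (subst card_Diff_subset) (auto simp: card_V_part)
  then have N: "(\<Sum>z\<in>V. of_bool (z \<in> ?N)) = int a - 2"
    using sum_of_bool_mem[OF finite_V, of ?N] two_le_a by auto
  have "dout w \<le> int a - 2 \<or> din w \<le> int a - 2"
    using assms(7)
  proof
    assume n: "\<not> E w x \<and> \<not> E w y"
    have "dout w \<le> (\<Sum>z\<in>V. of_bool (z \<in> ?N))"
      unfolding outdeg_def using E_cross n by (intro sum_mono) auto
    then show ?thesis using N by simp
  next
    assume n: "\<not> E x w \<and> \<not> E y w"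
    have "din w \<le> (\<Sum>z\<in>V. of_bool (z \<in> ?N))"
      unfolding indeg_def using E_cross n by (intro sum_mono) auto
    then show ?thesis using N by simp
  qed
  then show ?thesis using dout_le[of w] din_le[of w] by linarith
qed

lemma full_indegree_arc:
  assumes "din v = int a" "v \<in> V" "w \<in> V" "\<not> same v w"
  shows "E w v"
proof (rule ccontr)
  assume n: "\<not> E w v"
  let ?N = "{z \<in> V. \<not> same v z} - {w}"
  have "din v \<le> (\<Sum>z\<in>V. of_bool (z \<in> ?N))"
    unfolding indeg_def using E_cross n by (intro sum_mono) auto
  also have "\<dots> = int (card ?N)"
    by (intro sum_of_bool_mem finite_V) auto
  also have "\<dots> < int a"
    using assms finite_V card_V_part(2)[of v] psubset_card_mono[of "{z \<in> V. \<not> same v z}" ?N]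
    by auto
  finally show False using assms(1) by simp
qed

lemma ex_out:
  assumes "u \<in> V" obtains w where "w \<in> V" "E u w"
proof -
  have "{w \<in> V. \<not> same u w} \<noteq> {}" using card_V_part(2)[of u] two_le_a by (metis card.empty not_numeral_le_zero)
  then have "{u} \<noteq> V" by auto
  then show ?thesis using leave[of "{u}"] assms that by auto
qed

lemma ex_in:
  assumes "u \<in> V" obtains w where "w \<in> V" "E w u"
proof -
  have "{w \<in> V. \<not> same u w} \<noteq> {}" using card_V_part(2)[of u] two_le_a by (metis card.empty not_numeral_le_zero)
  then have "V \<noteq> {u}" by auto
  then have "V - {u} \<noteq> {}" using assms by auto
  then show ?thesis using leave[of "V - {u}"] assms that by blast
qed

definition swaps :: "('a \<Rightarrow> 'a) \<Rightarrow> bool" where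
  "swaps \<sigma> \<longleftrightarrow> \<sigma> permutes V \<and> (\<forall>v\<in>V. \<not> same v (\<sigma> v))"

lemma ex_swaps: "\<exists>\<sigma>. swaps \<sigma>"
proof -
  have fX: "finite X" using X_sub finite_V finite_subset by blast
  obtain f where f: "bij_betw f X (V - X)"
    using finite_same_card_bij[OF fX _ trans[OF card_X card_Y[symmetric]]] finite_V by auto
  let ?g = "inv_into X f"
  have g: "bij_betw ?g (V - X) X" by (rule bij_betw_inv_into[OF f])
  define \<sigma> where "\<sigma> v = (if v \<in> X then f v else if v \<in> V then ?g v else v)" for v
  have b1: "bij_betw \<sigma> X (V - X)"
    using f by (rule bij_betw_cong[THEN iffD1, rotated]) (simp add: \<sigma>_def)
  have b2: "bij_betw \<sigma> (V - X) X"
    using g by (rule bij_betw_cong[THEN iffD1, rotated]) (simp add: \<sigma>_def)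
  have "bij_betw \<sigma> (X \<union> (V - X)) ((V - X) \<union> X)"
    by (rule bij_betw_combine[OF b1 b2]) auto
  then have "bij_betw \<sigma> V V" using X_sub by (simp add: Un_commute Un_absorb2)
  then have "\<sigma> permutes V" using X_sub by (intro bij_imp_permutes) (auto simp: \<sigma>_def)
  moreover have "\<forall>v\<in>V. \<not> same v (\<sigma> v)" using b1 b2 bij_betwE by fastforce
  ultimately show ?thesis unfolding swaps_def by blast
qed

lemma swaps_in: "swaps \<sigma> \<Longrightarrow> v \<in> V \<Longrightarrow> \<sigma> v \<in> V"
  by (simp add: swaps_def permutes_in_image)

lemma swaps_comp_transpose:
  assumes "swaps \<sigma>" "u \<in> V" "v \<in> V" "same u v"
  shows "swaps (\<sigma> \<circ> transpose u v)"
  unfolding swaps_def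
proof
  show "\<sigma> \<circ> transpose u v permutes V"
    using assms by (intro permutes_compose permutes_swap_id) (auto simp: swaps_def)
  show "\<forall>w\<in>V. \<not> same w ((\<sigma> \<circ> transpose u v) w)"
    using assms by (auto simp: swaps_def transpose_def)
qed

lemma sum_permuted: "swaps \<sigma> \<Longrightarrow> (\<Sum>v\<in>V. g (\<sigma> v)) = sum g V" for g :: "'a \<Rightarrow> int"
  using sum.permute[of \<sigma> V g] by (simp add: swaps_def comp_def)

section \<open>Part-swapping permutations with at most one defect\<close>

definition defect :: "('a \<Rightarrow> 'a) \<Rightarrow> 'a set" where
  "defect \<sigma> = {v \<in> V. \<not> E v (\<sigma> v)}"

text \<open>Minimality is global, so it passes to every other permutation with equally few defects.\<close>
definition least_defect :: "('a \<Rightarrow> 'a) \<Rightarrow> bool" where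
  "least_defect \<sigma> \<longleftrightarrow> swaps \<sigma> \<and> (\<forall>\<tau>. swaps \<tau> \<longrightarrow> card (defect \<sigma>) \<le> card (defect \<tau>))"

lemma ex_least_defect: "\<exists>\<sigma>. least_defect \<sigma>"
  using ex_has_least_nat[of swaps _ "\<lambda>\<sigma>. card (defect \<sigma>)"] ex_swaps
  unfolding least_defect_def by blast

lemma finite_defect: "finite (defect \<sigma>)"
  using finite_V by (simp add: defect_def)

lemma defect_comp_transpose:
  assumes "u \<in> V" "v \<in> V" "u \<noteq> v"
  shows "defect (\<sigma> \<circ> transpose u v) = (defect \<sigma> - {u, v}) \<union>
    {w. w = u \<and> \<not> E u (\<sigma> v) \<or> w = v \<and> \<not> E v (\<sigma> u)}"
  using assms by (auto simp: defect_def transpose_def)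

text \<open>
  An exchange at a defect that gains one of the two new arcs cannot lower the number of defects. Hence
  it loses the other arc and destroys a pair that was good: it only moves the defect, and the new permutation is again minimal.
\<close>
lemma least_defect_exchange:
  assumes \<sigma>: "least_defect \<sigma>" and u: "u \<in> defect \<sigma>" and v: "v \<in> V" "v \<noteq> u" "same u v"
    and arc: "E u (\<sigma> v) \<or> E v (\<sigma> u)"
  shows "v \<notin> defect \<sigma>" "\<not> (E u (\<sigma> v) \<and> E v (\<sigma> u))"
    "least_defect (\<sigma> \<circ> transpose u v)"
    "E u (\<sigma> v) \<Longrightarrow> v \<in> defect (\<sigma> \<circ> transpose u v)"
    "E v (\<sigma> u) \<Longrightarrow> u \<in> defect (\<sigma> \<circ> transpose u v)"
proof -
  let ?\<tau> = "\<sigma> \<circ> transpose u v"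
  have uV: "u \<in> V" using u by (simp add: defect_def)
  have sw: "swaps ?\<tau>" using \<sigma> uV v by (intro swaps_comp_transpose) (auto simp: least_defect_def)
  have le: "card (defect \<sigma>) \<le> card (defect ?\<tau>)" using \<sigma> sw by (simp add: least_defect_def)
  have d: "defect ?\<tau> = (defect \<sigma> - {u, v}) \<union>
    {w. w = u \<and> \<not> E u (\<sigma> v) \<or> w = v \<and> \<not> E v (\<sigma> u)}" (is "_ = _ \<union> ?N")
    by (rule defect_comp_transpose) (use uV v in auto)
  show nd: "v \<notin> defect \<sigma>"
  proof
    assume v': "v \<in> defect \<sigma>"
    have "defect ?\<tau> \<subset> defect \<sigma>" using d u v' v(2) arc by blast
    then show False using le psubset_card_mono[OF finite_defect] leD by blast
  qed
  show ne: "\<not> (E u (\<sigma> v) \<and> E v (\<sigma> u))"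
  proof
    assume "E u (\<sigma> v) \<and> E v (\<sigma> u)"
    then have "defect ?\<tau> \<subset> defect \<sigma>" using d u by blast
    then show False using le psubset_card_mono[OF finite_defect] leD by blast
  qed
  have "\<exists>x. ?N = {x}"
    using arc ne v(2) by (cases "E u (\<sigma> v)") auto
  then obtain x where "?N = {x}" ..
  then have "defect ?\<tau> = insert x (defect \<sigma> - {u, v})" using d by simp
  also have "defect \<sigma> - {u, v} = defect \<sigma> - {u}" using nd by auto
  finally have "card (defect ?\<tau>) \<le> Suc (card (defect \<sigma> - {u}))"
    using finite_defect by (metis card_insert_le_m1 card_insert_if finite_Diff le_SucI order.refl)
  also have "\<dots> = card (defect \<sigma>)" by (rule card_Suc_Diff1[OF finite_defect u])
  finally show "least_defect ?\<tau>"
    using \<sigma> sw unfolding least_defect_def using order_trans by blast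
  show "v \<in> defect ?\<tau>" if "E u (\<sigma> v)" using d ne that by blast
  show "u \<in> defect ?\<tau>" if "E v (\<sigma> u)" using d ne that by blast
qed

text \<open>
  Since \<open>\<sigma>\<close> permutes the vertices, the left-hand side counts the arcs \<open>u \<rightarrow> \<sigma> v\<close> and
  \<open>v \<rightarrow> \<sigma> u\<close> over all \<open>v\<close>. Such a pair of potential arcs contributes at most one, and nothing if
  \<open>v\<close> is itself a defect or lies in the other part.
\<close>
lemma defect_degree_le:
  assumes \<sigma>: "least_defect \<sigma>" and u: "u \<in> defect \<sigma>"
  shows "dout u + din (\<sigma> u) \<le> int (card {v \<in> V. same u v \<and> v \<notin> defect \<sigma>})"
proof -
  have sw: "swaps \<sigma>" and uV: "u \<in> V" using \<sigma> u by (auto simp: least_defect_def defect_def)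
  have "dout u + din (\<sigma> u) = (\<Sum>v\<in>V. e u (\<sigma> v) + e v (\<sigma> u))"
    using sum_permuted[OF sw, of "\<lambda>w. e u w"] by (simp add: outdeg_def indeg_def sum.distrib)
  also have "\<dots> \<le> (\<Sum>v\<in>V. of_bool (same u v \<and> v \<notin> defect \<sigma>))"
  proof (rule sum_mono)
    fix v assume v: "v \<in> V"
    show "e u (\<sigma> v) + e v (\<sigma> u) \<le> of_bool (same u v \<and> v \<notin> defect \<sigma>)"
    proof (cases "E u (\<sigma> v) \<or> E v (\<sigma> u)")
      case arc: True
      have "same u v" using arc E_cross sw uV v unfolding swaps_def by blast
      moreover have "v \<noteq> u" using arc u by (auto simp: defect_def)
      ultimately show ?thesis
        using least_defect_exchange(1,2)[OF \<sigma> u v _ _ arc] by auto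
    qed simp
  qed
  also have "\<dots> = int (card {v \<in> V. same u v \<and> v \<notin> defect \<sigma>})"
    using finite_V by (simp add: Int_def)
  finally show ?thesis .
qed

lemma defect_degree_less:
  assumes \<sigma>: "least_defect \<sigma>" and u: "u \<in> defect \<sigma>"
  shows "dout u + din (\<sigma> u) \<le> int a - 1"
proof -
  have "{v \<in> V. same u v \<and> v \<notin> defect \<sigma>} \<subset> {v \<in> V. same u v}"
    using u by (auto simp: defect_def)
  then have "card {v \<in> V. same u v \<and> v \<notin> defect \<sigma>} < a"
    using psubset_card_mono[of "{v \<in> V. same u v}"] finite_V card_V_part(1)[of u] by simp
  then show ?thesis using defect_degree_le[OF assms] by linarith
qed

text \<open>
  With two defects in one part, the previous bound drops to \<open>a - 2\<close> for both of them. The total degree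
  of \<open>u\<close>, \<open>v\<close>, \<open>\<sigma> u\<close>, \<open>\<sigma> v\<close> is then at most \<open>2 (a - 2) + 4 a\<close>, while the degree condition
  for the pairs \<open>u, v\<close> and \<open>\<sigma> u, \<sigma> v\<close> demands \<open>2 (3 a - 1)\<close>.
\<close>
lemma defect_same_part_unique:
  assumes \<sigma>: "least_defect \<sigma>" and u: "u \<in> defect \<sigma>" and v: "v \<in> defect \<sigma>" and same: "same u v"
  shows "u = v"
proof (rule ccontr)
  assume ne: "u \<noteq> v"
  have V: "u \<in> V" "v \<in> V" and sw: "swaps \<sigma>" using \<sigma> u v by (auto simp: least_defect_def defect_def)
  have *: "int (card {w \<in> V. same z w \<and> w \<notin> defect \<sigma>}) \<le> int a - 2" if "same z u" for z
  proof -
    have "card {w \<in> V. same z w \<and> w \<notin> defect \<sigma>} \<le> card ({w \<in> V. same z w} - {u, v})"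
      using u v finite_V by (intro card_mono) auto
    also have "\<dots> = a - 2"
      using V same ne that by (subst card_Diff_subset) (auto simp: card_V_part)
    finally show ?thesis using two_le_a by linarith
  qed
  have "dout u + din (\<sigma> u) \<le> int a - 2" "dout v + din (\<sigma> v) \<le> int a - 2"
    using defect_degree_le[OF \<sigma> u] defect_degree_le[OF \<sigma> v] *[of u] *[of v] same by auto
  moreover have "3 * int a - 1 \<le> dout u + din u + (dout v + din v)"
    using degree_sum V same ne by blast
  moreover have "\<sigma> u \<noteq> \<sigma> v"
    using ne sw by (auto simp: swaps_def dest: permutes_inj injD)
  then have "3 * int a - 1 \<le> dout (\<sigma> u) + din (\<sigma> u) + (dout (\<sigma> v) + din (\<sigma> v))"
    using degree_sum swaps_in[OF sw] V same sw unfolding swaps_def by blast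
  ultimately show False
    using dout_le[of "\<sigma> u"] dout_le[of "\<sigma> v"] din_le[of u] din_le[of v] by linarith
qed

text \<open>
  Following an arc out of a defect \<open>u\<close> moves the tail of the defective pair from \<open>u\<close> to \<open>v\<close>, while its
  head \<open>\<sigma> u\<close> stays in place.
\<close>
lemma defect_shift_tail:
  assumes \<sigma>: "least_defect \<sigma>" and u: "u \<in> defect \<sigma>" and v: "v \<in> V" "E u (\<sigma> v)"
  shows "v \<noteq> u" "same u v" "least_defect (\<sigma> \<circ> transpose u v)" "v \<in> defect (\<sigma> \<circ> transpose u v)"
proof -
  have sw: "swaps \<sigma>" using \<sigma> by (simp add: least_defect_def)
  show "v \<noteq> u" using v u by (auto simp: defect_def)
  moreover show "same u v" using v(2) E_cross sw v(1) unfolding swaps_def by blast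
  ultimately show "least_defect (\<sigma> \<circ> transpose u v)" "v \<in> defect (\<sigma> \<circ> transpose u v)"
    using least_defect_exchange(3,4)[OF \<sigma> u v(1)] v(2) by auto
qed

lemma ex_swaps_preimage:
  assumes "swaps \<sigma>" "w \<in> V" obtains v where "v \<in> V" "\<sigma> v = w"
  using assms permutes_image[of \<sigma> V] unfolding swaps_def by (metis imageE)

text \<open>
  An arc \<open>v \<rightarrow> \<sigma> u\<close> moves the head of the defective pair from \<open>\<sigma> u\<close> to \<open>\<sigma> v\<close> and keeps its tail
  \<open>u\<close>, so the defect bound holds for both heads. The degree condition for the heads makes the sum of
  their in-degrees at least \<open>a - 1\<close>, which leaves little room for \<open>dout u\<close>.
\<close>
lemma defect_tail_outdegree:
  assumes \<sigma>: "least_defect \<sigma>" and u: "u \<in> defect \<sigma>"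
  shows "2 * dout u \<le> int a - 1"
proof -
  have sw: "swaps \<sigma>" and uV: "u \<in> V" using \<sigma> u by (auto simp: least_defect_def defect_def)
  obtain v where v: "v \<in> V" "E v (\<sigma> u)"
    using ex_in[OF swaps_in[OF sw uV]] by metis
  have ne: "v \<noteq> u" using v u by (auto simp: defect_def)
  have same: "same u v" using v(2) E_cross sw uV unfolding swaps_def by blast
  note s = least_defect_exchange(3,5)[OF \<sigma> u v(1) ne same]
  have "dout u + din (\<sigma> u) \<le> int a - 1" by (rule defect_degree_less[OF \<sigma> u])
  moreover have "dout u + din (\<sigma> v) \<le> int a - 1"
    using defect_degree_less[OF s(1,2)] v(2) by simp
  moreover have "\<sigma> u \<noteq> \<sigma> v"
    using ne sw by (auto simp: swaps_def dest: permutes_inj injD)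
  then have "3 * int a - 1 \<le> dout (\<sigma> u) + din (\<sigma> u) + (dout (\<sigma> v) + din (\<sigma> v))"
    using degree_sum swaps_in[OF sw] uV v(1) same sw unfolding swaps_def by blast
  ultimately show ?thesis using dout_le[of "\<sigma> u"] dout_le[of "\<sigma> v"] by linarith
qed

text \<open>
  Both tails \<open>u\<close> and \<open>v\<close> have out-degree at most \<open>(a - 1) / 2\<close>, and in-degrees are at most \<open>a\<close>; these
  bounds add up to exactly \<open>3 a - 1\<close>, so the degree condition turns all of them into equalities.
\<close>
lemma defect_degrees:
  assumes \<sigma>: "least_defect \<sigma>" and u: "u \<in> defect \<sigma>"
  shows "din u = int a" "2 * dout u = int a - 1"
    "\<And>v. v \<in> V \<Longrightarrow> E u (\<sigma> v) \<Longrightarrow> din v = int a"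
proof -
  have sw: "swaps \<sigma>" and uV: "u \<in> V" using \<sigma> u by (auto simp: least_defect_def defect_def)
  have *: "din u = int a \<and> 2 * dout u = int a - 1 \<and> din v = int a"
    if v: "v \<in> V" "E u (\<sigma> v)" for v
  proof -
    note s = defect_shift_tail[OF \<sigma> u v]
    have "2 * dout u \<le> int a - 1" by (rule defect_tail_outdegree[OF \<sigma> u])
    moreover have "2 * dout v \<le> int a - 1" by (rule defect_tail_outdegree[OF s(3,4)])
    moreover have "3 * int a - 1 \<le> dout u + din u + (dout v + din v)"
      using degree_sum uV v(1) s by blast
    ultimately show ?thesis using din_le[of u] din_le[of v] by linarith
  qed
  obtain v where v: "v \<in> V" "E u (\<sigma> v)"
    using ex_out[OF uV] ex_swaps_preimage[OF sw] by metis
  from *[OF v] show "din u = int a" "2 * dout u = int a - 1" by auto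
  show "din v = int a" if "v \<in> V" "E u (\<sigma> v)" for v using *[OF that] by simp
qed

text \<open>
  If \<open>u\<close> and \<open>w\<close> are defects in different parts, then \<open>w\<close> has an arc to every vertex of full in-degree
  in the part of \<open>u\<close>. These include \<open>u\<close> and all \<open>v\<close> with \<open>u \<rightarrow> \<sigma> v\<close>, so \<open>dout w > dout u\<close>;
  but both out-degrees equal \<open>(a - 1) / 2\<close>.
\<close>
lemma defect_unique:
  assumes \<sigma>: "least_defect \<sigma>" and u: "u \<in> defect \<sigma>" and w: "w \<in> defect \<sigma>"
  shows "u = w"
proof (cases "same u w")
  case True
  then show ?thesis by (rule defect_same_part_unique[OF assms])
next
  case False
  have sw: "swaps \<sigma>" and V: "u \<in> V" "w \<in> V"
    using \<sigma> u w by (auto simp: least_defect_def defect_def)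
  have "e u (\<sigma> v) + of_bool (v = u) \<le> e w v" if v: "v \<in> V" for v
  proof (cases "E u (\<sigma> v) \<or> v = u")
    case True
    have s: "same u v" using True E_cross[of u "\<sigma> v"] sw v unfolding swaps_def by blast
    have "din v = int a" using True defect_degrees[OF \<sigma> u] v by blast
    then have "E w v" using full_indegree_arc v V False s by blast
    moreover have "\<not> (E u (\<sigma> v) \<and> v = u)" using u by (auto simp: defect_def)
    ultimately show ?thesis by auto
  qed auto
  then have "(\<Sum>v\<in>V. e u (\<sigma> v) + of_bool (v = u)) \<le> dout w"
    unfolding outdeg_def by (intro sum_mono)
  moreover have "(\<Sum>v\<in>V. e u (\<sigma> v) + of_bool (v = u)) = dout u + 1"
    using sum_permuted[OF sw, of "\<lambda>w. e u w"] V finite_V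
    by (simp add: outdeg_def sum.distrib of_bool_def sum.delta)
  ultimately show ?thesis
    using defect_degrees(2)[OF \<sigma> u] defect_degrees(2)[OF \<sigma> w] by linarith
qed

section \<open>Enlarging the orbit of the gap\<close>

text \<open>
  The orbit of \<open>b\<close> is a path from \<open>\<sigma> b\<close> to \<open>b\<close> and the other orbits are cycles. The pair
  \<open>(b, \<sigma> b)\<close> may or may not be an arc, so a permutation without defects has a gap at every vertex.
\<close>
definition one_gap :: "('a \<Rightarrow> 'a) \<Rightarrow> 'a \<Rightarrow> bool" where
  "one_gap \<sigma> b \<longleftrightarrow> swaps \<sigma> \<and> b \<in> V \<and> (\<forall>v\<in>V. v \<noteq> b \<longrightarrow> E v (\<sigma> v))"

definition largest_gap_orbit :: "('a \<Rightarrow> 'a) \<Rightarrow> 'a \<Rightarrow> bool" where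
  "largest_gap_orbit \<sigma> b \<longleftrightarrow> one_gap \<sigma> b \<and>
    (\<forall>\<tau> c. one_gap \<tau> c \<longrightarrow> card (orbit \<tau> c) \<le> card (orbit \<sigma> b))"

lemma ex_one_gap: "\<exists>\<sigma> b. one_gap \<sigma> b"
proof -
  obtain \<sigma> where \<sigma>: "least_defect \<sigma>" using ex_least_defect by blast
  have "V \<noteq> {}" using card_V_part(1) two_le_a by force
  then obtain v where v: "v \<in> V" by blast
  show ?thesis
  proof (cases "defect \<sigma> = {}")
    case True
    then show ?thesis using \<sigma> v by (auto simp: one_gap_def least_defect_def defect_def)
  next
    case False
    then obtain b where b: "b \<in> defect \<sigma>" by blast
    have "one_gap \<sigma> b" unfolding one_gap_def
    proof (intro conjI ballI impI)
      show "swaps \<sigma>" using \<sigma> by (simp add: least_defect_def)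
      show "b \<in> V" using b by (simp add: defect_def)
      fix w assume "w \<in> V" "w \<noteq> b"
      then show "E w (\<sigma> w)" using defect_unique[OF \<sigma> b, of w] by (auto simp: defect_def)
    qed
    then show ?thesis by blast
  qed
qed

lemma one_gap_orbit:
  assumes "one_gap \<sigma> b"
  shows "permutation \<sigma>" "b \<in> orbit \<sigma> b" "orbit \<sigma> b \<subseteq> V"
proof -
  have "\<sigma> permutes V" and b: "b \<in> V" using assms by (auto simp: one_gap_def swaps_def)
  then show p: "permutation \<sigma>" using finite_V permutation_permutes by blast
  show "b \<in> orbit \<sigma> b" by (rule permutation_self_in_orbit[OF p])
  show "orbit \<sigma> b \<subseteq> V" by (rule permutes_orbit_subset[OF \<open>\<sigma> permutes V\<close> b])
qed

lemma ex_largest_gap_orbit: "\<exists>\<sigma> b. largest_gap_orbit \<sigma> b"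
proof -
  obtain \<sigma> b where 0: "one_gap \<sigma> b" using ex_one_gap by blast
  have "\<forall>q. (case q of (\<tau>, c) \<Rightarrow> one_gap \<tau> c) \<longrightarrow>
      (case q of (\<tau>, c) \<Rightarrow> card (orbit \<tau> c)) < Suc (card V)"
    using one_gap_orbit(3) finite_V by (auto simp: less_Suc_eq_le intro: card_mono)
  from ex_has_greatest_nat[of "\<lambda>(\<tau>, c). one_gap \<tau> c" "(\<sigma>, b)", OF _ this]
  show ?thesis using 0 unfolding largest_gap_orbit_def by auto
qed

text \<open>
  An exchange between the gap orbit and its complement splices a whole cycle into the path. It
  contradicts maximality wherever the new gap ends up in the enlarged orbit.
\<close>
lemma largest_gap_orbit_no_merge:
  assumes max: "largest_gap_orbit \<sigma> b" and v: "v \<in> orbit \<sigma> b"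
    and u: "u \<in> V - orbit \<sigma> b" and c: "c \<in> insert u (orbit \<sigma> b)"
  shows "\<not> one_gap (\<sigma> \<circ> transpose u v) c"
proof
  let ?\<tau> = "\<sigma> \<circ> transpose u v"
  assume gap: "one_gap ?\<tau> c"
  have gap0: "one_gap \<sigma> b" using max by (simp add: largest_gap_orbit_def)
  have sub: "insert u (orbit \<sigma> b) \<subseteq> orbit ?\<tau> v"
    by (rule orbit_comp_transpose_merge[OF one_gap_orbit(1)[OF gap0] v]) (use u in simp)
  have "orbit ?\<tau> c = orbit ?\<tau> v"
    by (rule orbit_cyclic_eq3[OF cyclic_on_orbit'[OF one_gap_orbit(1)[OF gap]]]) (use c sub in auto)
  then have "orbit \<sigma> b \<subset> orbit ?\<tau> c" using sub u by auto
  then have "card (orbit \<sigma> b) < card (orbit ?\<tau> c)"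
    using one_gap_orbit(3)[OF gap] finite_V by (meson finite_subset psubset_card_mono)
  then show False using max gap by (auto simp: largest_gap_orbit_def leD)
qed

end

section \<open>A longest gap orbit that misses a vertex\<close>

locale nonspanning_gap_orbit = strong_bipartite +
  fixes \<sigma> :: "'a \<Rightarrow> 'a" and b :: 'a
  assumes max: "largest_gap_orbit \<sigma> b"
    and nonspanning: "orbit \<sigma> b \<noteq> V"
begin

definition "P = orbit \<sigma> b"
definition "C = V - P"

lemma gap: "one_gap \<sigma> b"
  using max by (simp add: largest_gap_orbit_def)

lemma swaps_\<sigma>: "swaps \<sigma>" and bV: "b \<in> V"
  using gap by (auto simp: one_gap_def)

lemma arc_off_gap: "v \<in> V \<Longrightarrow> v \<noteq> b \<Longrightarrow> E v (\<sigma> v)"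
  using gap by (simp add: one_gap_def)

lemma bP: "b \<in> P" and PV: "P \<subseteq> V"
  using one_gap_orbit[OF gap] by (auto simp: P_def)

lemma CV: "C \<subseteq> V" and C_ne: "C \<noteq> {}"
  using PV nonspanning by (auto simp: C_def P_def)

lemma finite_P: "finite P" and finite_C: "finite C"
  using finite_V PV finite_subset by (auto simp: C_def)

lemma V_split: "V = C \<union> P" "C \<inter> P = {}"
  using PV by (auto simp: C_def)

lemma opposite: "v \<in> V \<Longrightarrow> \<not> same v (\<sigma> v)"
  using swaps_\<sigma> by (auto simp: swaps_def)

lemma bij_P: "bij_betw \<sigma> P P"
proof -
  have "inj_on \<sigma> P" using swaps_\<sigma> by (auto simp: swaps_def intro: permutes_inj_on)
  moreover have "\<sigma> ` P \<subseteq> P" by (auto simp: P_def intro: orbit.step)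
  ultimately show ?thesis using finite_P by (simp add: bij_betw_def endo_inj_surj)
qed

lemma bij_C: "bij_betw \<sigma> C C"
proof -
  have "bij_betw \<sigma> V V" using swaps_\<sigma> by (auto simp: swaps_def permutes_imp_bij)
  from bij_betw_DiffI[OF this bij_P PV PV] show ?thesis by (simp add: C_def)
qed

lemma parts_equal:
  assumes "bij_betw \<sigma> S S" "S \<subseteq> V"
  shows "card (S \<inter> X) = card (S - X)"
proof -
  have img: "\<sigma> ` S = S" by (rule bij_betw_imp_surj_on[OF assms(1)])
  have "\<sigma> ` (S \<inter> X) = S - X"
  proof (intro equalityI subsetI)
    fix w assume "w \<in> \<sigma> ` (S \<inter> X)"
    then obtain v where "v \<in> S" "v \<in> X" "w = \<sigma> v" by blast
    moreover have "\<sigma> v \<in> S" using imageI[OF \<open>v \<in> S\<close>, of \<sigma>] img by simp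
    ultimately show "w \<in> S - X" using opposite[of v] assms(2) by auto
  next
    fix w assume w: "w \<in> S - X"
    then obtain v where "v \<in> S" "w = \<sigma> v" using img by (metis DiffD1 imageE)
    moreover have "v \<in> X" using opposite[of v] calculation w assms(2) by auto
    ultimately show "w \<in> \<sigma> ` (S \<inter> X)" by blast
  qed
  moreover have "inj_on \<sigma> (S \<inter> X)" using assms(1) by (auto simp: bij_betw_def inj_on_def)
  ultimately show ?thesis by (metis card_image)
qed

definition "r = card (P \<inter> X)"
definition "k = card (C \<inter> X)"

lemma P_cards: "card (P \<inter> X) = r" "card (P - X) = r"
  using parts_equal[OF bij_P PV] by (simp_all add: r_def)

lemma C_cards: "card (C \<inter> X) = k" "card (C - X) = k"
  using parts_equal[OF bij_C CV] by (simp_all add: k_def)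

lemma P_parts: "card {w \<in> P. same u w} = r" "card {w \<in> P. \<not> same u w} = r"
  by (rule card_part[OF PV P_cards])+

lemma C_parts: "card {w \<in> C. same u w} = k" "card {w \<in> C. \<not> same u w} = k"
  by (rule card_part[OF CV C_cards])+

lemma sizes: "card P = 2 * r" "card C = 2 * k" "r + k = a" "r > 0" "k > 0"
proof -
  show P: "card P = 2 * r"
    using card_Int_Diff[OF finite_P, of X] P_cards by simp
  show C: "card C = 2 * k"
    using card_Int_Diff[OF finite_C, of X] C_cards by simp
  have "card (P \<inter> X) + card (C \<inter> X) = card ((P \<inter> X) \<union> (C \<inter> X))"
    using finite_P finite_C V_split by (subst card_Un_disjoint) auto
  also have "(P \<inter> X) \<union> (C \<inter> X) = X" using V_split X_sub by auto
  finally show "r + k = a" using card_X by (simp add: r_def k_def)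
  show "r > 0" "k > 0" using P C bP C_ne finite_P finite_C by (metis card_gt_0_iff empty_iff mult_0_right gr0I)+
qed

text \<open>
  For \<open>v \<noteq> b\<close> an exchange needs both new arcs, because the gap remains at \<open>b\<close>. For \<open>v = b\<close> the
  pair at the gap is given up, so one new arc is enough: the missing one becomes the new gap, at \<open>b\<close>
  or at \<open>u\<close>.
\<close>
lemma exchange_arcs:
  assumes u: "u \<in> C" and v: "v \<in> P" and s: "same u v"
  shows "\<not> (E u (\<sigma> v) \<and> E v (\<sigma> u))" "v = b \<Longrightarrow> \<not> E u (\<sigma> v) \<and> \<not> E v (\<sigma> u)"
proof -
  let ?\<tau> = "\<sigma> \<circ> transpose u v"
  have V: "u \<in> V" "v \<in> V" using u v PV by (auto simp: C_def)
  have ne: "u \<noteq> v" "u \<noteq> b" using u v bP by (auto simp: C_def)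
  have swt: "swaps ?\<tau>" by (rule swaps_comp_transpose[OF swaps_\<sigma> V s])
  have other: "E w (?\<tau> w)" if "w \<in> V" "w \<noteq> b" "w \<noteq> u" "w \<noteq> v" for w
    using that arc_off_gap by (simp add: transpose_def)
  have no: "\<not> one_gap ?\<tau> c" if "c = u \<or> c = b" for c
    by (rule largest_gap_orbit_no_merge[OF max]) (use u v bP that in \<open>auto simp: P_def C_def\<close>)
  show "\<not> (E u (\<sigma> v) \<and> E v (\<sigma> u))"
  proof
    assume A: "E u (\<sigma> v) \<and> E v (\<sigma> u)"
    have "E w (?\<tau> w)" if "w \<in> V" "w \<noteq> b" for w
      using that A other[of w] by (cases "w = u"; cases "w = v") auto
    then have "one_gap ?\<tau> b" using swt bV by (simp add: one_gap_def)
    then show False using no by blast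
  qed
  show "\<not> E u (\<sigma> v) \<and> \<not> E v (\<sigma> u)" if vb: "v = b"
  proof
    show "\<not> E u (\<sigma> v)"
    proof
      assume A: "E u (\<sigma> v)"
      have "E w (?\<tau> w)" if "w \<in> V" "w \<noteq> b" for w
        using that A other[of w] vb by (cases "w = u") auto
      then have "one_gap ?\<tau> b" using swt bV by (simp add: one_gap_def)
      then show False using no by blast
    qed
    show "\<not> E v (\<sigma> u)"
    proof
      assume A: "E v (\<sigma> u)"
      have "E w (?\<tau> w)" if "w \<in> V" "w \<noteq> u" for w
        using that A other[of w] vb by (cases "w = b") auto
      then have "one_gap ?\<tau> u" using swt V by (simp add: one_gap_def)
      then show False using no by blast
    qed
  qed
qed

text \<open>
  Otherwise \<open>\<sigma>\<close> has no defect at all, and one may exchange along any arc leaving \<open>P\<close>: only the other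
  new pair can be bad, and it becomes the gap.
\<close>
lemma gap_not_arc: "\<not> E b (\<sigma> b)"
proof
  assume Eb: "E b (\<sigma> b)"
  have "P \<noteq> V" using C_ne C_def by auto
  then obtain x w where xw: "x \<in> P" "w \<in> C" "E x w"
    using leave[OF PV] bP C_def by blast
  obtain v where v: "v \<in> C" "\<sigma> v = w"
    using bij_betw_imp_surj_on[OF bij_C] xw(2) by (metis imageE)
  have V: "x \<in> V" "v \<in> V" using xw v PV by (auto simp: C_def)
  have s: "same v x" using E_cross[OF xw(3)] opposite[OF V(2)] v(2) by blast
  let ?\<tau> = "\<sigma> \<circ> transpose v x"
  have "E z (?\<tau> z)" if "z \<in> V" "z \<noteq> v" for z
    using that xw(3) v(2) arc_off_gap[of z] Eb by (cases "z = x"; cases "z = b") (auto simp: transpose_def)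
  then have "one_gap ?\<tau> v"
    using swaps_comp_transpose[OF swaps_\<sigma> V(2,1) s] V by (simp add: one_gap_def)
  moreover have "\<not> one_gap ?\<tau> v"
    by (rule largest_gap_orbit_no_merge[OF max]) (use xw v in \<open>auto simp: P_def C_def\<close>)
  ultimately show False by blast
qed

text \<open>The path ends in \<open>b\<close>; an arc from there into a cycle would extend it.\<close>
lemma gap_out_in_P: "E b w \<Longrightarrow> w \<in> P"
proof (rule ccontr)
  assume w: "E b w" "w \<notin> P"
  then have "w \<in> C" using E_cross C_def by blast
  then obtain u where u: "u \<in> C" "\<sigma> u = w" using bij_betw_imp_surj_on[OF bij_C] by (metis imageE)
  have "same u b" using E_cross[OF w(1)] opposite[of u] u C_def by blast
  then show False using exchange_arcs(2)[OF u(1) bP] u w by blast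
qed

text \<open>If \<open>r = 1\<close>, the only possible out-neighbour of \<open>b\<close> is \<open>\<sigma> b\<close>.\<close>
lemma r_ge_2: "r \<ge> 2"
proof (rule ccontr)
  assume "\<not> r \<ge> 2"
  then have "card {w \<in> P. \<not> same b w} \<le> Suc 0" using P_parts(2)[of b] by simp
  moreover have "finite {w \<in> P. \<not> same b w}" using finite_P finite_C by simp
  ultimately have one: "x = y" if "x \<in> P" "\<not> same b x" "y \<in> P" "\<not> same b y" for x y
    using that by (simp add: card_le_Suc0_iff_eq)
  obtain w where w: "w \<in> V" "E b w" using ex_out[OF bV] .
  have "w \<in> P" "\<not> same b w" using gap_out_in_P[OF w(2)] E_cross[OF w(2)] by simp_all
  moreover have "\<sigma> b \<in> P" using bij_P bP by (auto simp: bij_betw_def)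
  ultimately have "w = \<sigma> b" using one opposite[OF bV] by blast
  then show False using w(2) gap_not_arc by simp
qed

text \<open>
  As \<open>\<sigma>\<close> permutes \<open>P\<close> and \<open>C\<close> separately, the arcs between them can be counted as the arcs
  \<open>u \<rightarrow> \<sigma> v\<close> and \<open>v \<rightarrow> \<sigma> u\<close> over \<open>u \<in> C\<close>, \<open>v \<in> P\<close>. Only pairs in the same part contribute, each at
  most one arc, and none for \<open>v = b\<close>: there remain \<open>2 r - 1\<close> choices of \<open>v\<close> with \<open>k\<close> choices of \<open>u\<close>.
\<close>
lemma cut_le: "(\<Sum>u\<in>C. \<Sum>v\<in>P. e u v + e v u) \<le> int k * (2 * int r - 1)"
proof -
  have *: "(\<Sum>u\<in>C. \<Sum>v\<in>P. e u v) = (\<Sum>u\<in>C. \<Sum>v\<in>P. e u (\<sigma> v))"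
    by (rule sum.cong[OF refl], rule sum.reindex_bij_betw[OF bij_P, symmetric])
  have **: "(\<Sum>u\<in>C. \<Sum>v\<in>P. e v u) = (\<Sum>u\<in>C. \<Sum>v\<in>P. e v (\<sigma> u))"
    using sum.reindex_bij_betw[OF bij_C, of "\<lambda>u. \<Sum>v\<in>P. e v u"] by simp
  have "(\<Sum>u\<in>C. \<Sum>v\<in>P. e u v + e v u) = (\<Sum>u\<in>C. \<Sum>v\<in>P. e u (\<sigma> v) + e v (\<sigma> u))"
    using * ** by (simp add: sum.distrib)
  also have "\<dots> = (\<Sum>v\<in>P. \<Sum>u\<in>C. e u (\<sigma> v) + e v (\<sigma> u))" by (rule sum.swap)
  also have "\<dots> \<le> (\<Sum>v\<in>P. \<Sum>u\<in>C. of_bool (u \<in> {w \<in> C. same v w} \<and> v \<noteq> b))"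
  proof (intro sum_mono)
    fix u v assume u: "u \<in> C" and v: "v \<in> P"
    show "e u (\<sigma> v) + e v (\<sigma> u) \<le> of_bool (u \<in> {w \<in> C. same v w} \<and> v \<noteq> b)"
    proof (cases "same u v")
      case True
      then show ?thesis
        using exchange_arcs(1)[OF u v True] exchange_arcs(2)[OF u v True] u
        by (cases "v = b"; cases "E u (\<sigma> v)") simp_all
    next
      case False
      have uV: "u \<in> V" and vV: "v \<in> V" using u v PV by (auto simp: C_def)
      from False have "\<not> E u (\<sigma> v)" "\<not> E v (\<sigma> u)"
        using E_cross[of u "\<sigma> v"] E_cross[of v "\<sigma> u"] opposite[of u] opposite[of v] uV vV by blast+
      then show ?thesis by simp
    qed
  qed
  also have "\<dots> = (\<Sum>v\<in>P. of_bool (v \<in> P - {b}) * int k)"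
  proof (intro sum.cong refl)
    fix v assume "v \<in> P"
    have "(\<Sum>u\<in>C. of_bool (u \<in> {w \<in> C. same v w})) = int (card {w \<in> C. same v w})"
      by (intro sum_of_bool_mem finite_P finite_C) auto
    then show "(\<Sum>u\<in>C. of_bool (u \<in> {w \<in> C. same v w} \<and> v \<noteq> b)) = of_bool (v \<in> P - {b}) * int k"
      using \<open>v \<in> P\<close> C_parts(1)[of v] by (cases "v = b") simp_all
  qed
  also have "\<dots> = int (card (P - {b})) * int k"
    using sum_of_bool_mem[OF finite_P, of "P - {b}"] by (simp only: sum_distrib_right[symmetric] Diff_subset)
  also have "card (P - {b}) = 2 * r - 1" using sizes(1) bP finite_P finite_C by simp
  finally show ?thesis using sizes(4) by (simp add: of_nat_diff algebra_simps)
qed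

lemma degree_split:
  "dout u + din u = (\<Sum>w\<in>C. e u w + e w u) + (\<Sum>w\<in>P. e u w + e w u)"
  unfolding degree_altdef
  by (subst V_split(1)) (rule sum.union_disjoint[OF finite_C finite_P V_split(2)])

lemma degree_sum_C_le: "(\<Sum>u\<in>C. dout u + din u) \<le> int k * (4 * int k + 2 * int r - 1)"
proof -
  have "(\<Sum>w\<in>C. e u w + e w u) \<le> 2 * int k" for u
    using degree_into_le[OF _ C_parts(2), of u] by (simp add: C_def sum.distrib)
  then have "(\<Sum>u\<in>C. \<Sum>w\<in>C. e u w + e w u) \<le> (\<Sum>u\<in>C. 2 * int k)"
    by (intro sum_mono)
  also have "\<dots> = 4 * int k * int k" using sizes(2) by simp
  finally have "(\<Sum>u\<in>C. \<Sum>w\<in>C. e u w + e w u) \<le> 4 * int k * int k" .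
  moreover have "(\<Sum>u\<in>C. dout u + din u) =
      (\<Sum>u\<in>C. \<Sum>w\<in>C. e u w + e w u) + (\<Sum>u\<in>C. \<Sum>v\<in>P. e u v + e v u)"
    by (simp only: degree_split) (rule sum.distrib)
  ultimately show ?thesis using cut_le by (simp only: algebra_simps)
qed

text \<open>The inequality is strict because the arc from \<open>b\<close> to \<open>\<sigma> b\<close> is missing inside \<open>P\<close>.\<close>
lemma degree_sum_P_less:
  "(\<Sum>u\<in>P. dout u + din u) < 4 * int r * int r + int k * (2 * int r - 1)"
proof -
  have le: "(\<Sum>w\<in>P. e u w + e w u) \<le> 2 * int r" for u
    using degree_into_le[OF PV P_parts(2), of u] by (simp add: sum.distrib)
  have "(\<Sum>w\<in>P. e b w) < int r"
  proof -
    let ?N = "{w \<in> P. \<not> same b w} - {\<sigma> b}"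
    have "(\<Sum>w\<in>P. e b w) \<le> (\<Sum>w\<in>P. of_bool (w \<in> ?N))"
      using E_cross gap_not_arc by (intro sum_mono) auto
    also have "\<dots> = int (card ?N)" by (intro sum_of_bool_mem finite_P finite_C) auto
    also have "\<dots> < int (card {w \<in> P. \<not> same b w})"
      using opposite[OF bV] bij_P bP finite_P finite_C
      by (intro of_nat_less_iff[THEN iffD2] card_Diff1_less) (auto simp: bij_betw_def)
    finally show ?thesis by (simp only: P_parts(2))
  qed
  then have lt: "(\<Sum>w\<in>P. e b w + e w b) < 2 * int r"
    using degree_into_le(2)[OF PV P_parts(2), of b] by (simp add: sum.distrib)
  have "(\<Sum>u\<in>P. \<Sum>w\<in>P. e u w + e w u) < (\<Sum>u\<in>P. 2 * int r)"
    using le lt bP finite_P finite_C by (intro sum_strict_mono_ex1) auto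
  also have "\<dots> = 4 * int r * int r" using sizes(1) by simp
  finally have "(\<Sum>u\<in>P. \<Sum>w\<in>P. e u w + e w u) < 4 * int r * int r" .
  moreover have "(\<Sum>u\<in>P. \<Sum>w\<in>C. e u w + e w u) = (\<Sum>u\<in>C. \<Sum>v\<in>P. e u v + e v u)"
    by (rule trans[OF sum.swap]) (intro sum.cong refl add.commute)
  moreover have "(\<Sum>u\<in>P. dout u + din u) =
      (\<Sum>u\<in>P. \<Sum>w\<in>C. e u w + e w u) + (\<Sum>u\<in>P. \<Sum>w\<in>P. e u w + e w u)"
    by (simp only: degree_split) (rule sum.distrib)
  ultimately show ?thesis using cut_le by linarith
qed

lemma k_eq_1: "k = 1"
proof (rule ccontr)
  assume "k \<noteq> 1"
  then have k2: "k \<ge> 2" using sizes(5) by linarith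
  have ra: "int a = int r + int k" using sizes(3) by simp
  have "int k * (3 * int a - 1) \<le> int k * (4 * int k + 2 * int r - 1)"
    using degree_sum_ge[OF CV C_cards k2] degree_sum_C_le by (rule order_trans)
  then have "3 * int a - 1 \<le> 4 * int k + 2 * int r - 1"
    using sizes(5) by (simp add: mult_le_cancel_left_pos)
  then have rk: "int r \<le> int k" using ra by linarith
  have "int r * (3 * int a - 1) < 4 * int r * int r + int k * (2 * int r - 1)"
    using degree_sum_ge[OF PV P_cards r_ge_2] degree_sum_P_less by (rule order.strict_trans1)
  then have "(int r + 1) * int k < (int r + 1) * int r"
    unfolding ra by (simp add: algebra_simps)
  then have "int k < int r" using r_ge_2 by (simp add: mult_less_cancel_left_pos)
  with rk show False by simp
qed

text \<open>
  Now \<open>C = {x, y}\<close> with \<open>x\<close> in the part of \<open>b\<close> and \<open>y\<close> in the part of \<open>\<sigma> b\<close>. Of the arcs from \<open>b\<close>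
  to \<open>\<sigma> b\<close> and \<open>y\<close>, and of those from \<open>b\<close> and \<open>x\<close> to \<open>\<sigma> b\<close>, none is present. The degree condition for
  \<open>x, b\<close> and for \<open>y, \<sigma> b\<close> therefore requires \<open>2 a + 2\<close> from the degrees of \<open>x\<close> and \<open>y\<close> together,
  one more than is available.
\<close>
lemma contradiction: False
proof -
  have ra: "int a = int r + 1" using sizes(3) k_eq_1 by simp
  have parts: "card {w \<in> C. same b w} = 1" "card {w \<in> C. \<not> same b w} = 1"
    using C_parts k_eq_1 by simp_all
  obtain x where x: "{w \<in> C. same b w} = {x}" using parts(1) card_1_singletonE by blast
  obtain y where y: "{w \<in> C. \<not> same b w} = {y}" using parts(2) card_1_singletonE by blast
  have C: "C = {x, y}" and xy: "x \<noteq> y" "same b x" "\<not> same b y" "x \<in> C" "y \<in> C"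
    using x y by blast+
  have V: "x \<in> V" "y \<in> V" using xy by (auto simp: C_def)
  have "\<sigma> x \<in> C" using bij_C xy(4) by (auto simp: bij_betw_def)
  then have sx: "\<sigma> x = y" using C opposite[OF V(1)] by auto
  have sb: "\<sigma> b \<in> V" "\<sigma> b \<in> P" "\<not> same b (\<sigma> b)"
    using opposite[OF bV] bij_P bP PV by (auto simp: bij_betw_def)
  have ex: "\<not> E x (\<sigma> b)" "\<not> E b y"
    using exchange_arcs(2)[OF xy(4) bP] xy(2) sx by auto
  have Pne: "x \<notin> P" "y \<notin> P" using xy by (auto simp: C_def)
  have b_low: "dout b + din b \<le> 2 * int a - 2"
    by (rule two_missing_arcs[of b y "\<sigma> b"]) (use ex gap_not_arc V bV sb xy Pne in auto)
  have sb_low: "dout (\<sigma> b) + din (\<sigma> b) \<le> 2 * int a - 2"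
    by (rule two_missing_arcs[of "\<sigma> b" x b]) (use ex gap_not_arc V bV bP sb xy Pne in auto)
  have "3 * int a - 1 \<le> dout x + din x + (dout b + din b)"
    using degree_sum[OF V(1) bV] xy Pne bP by blast
  moreover have "3 * int a - 1 \<le> dout y + din y + (dout (\<sigma> b) + din (\<sigma> b))"
    using degree_sum[OF V(2) sb(1)] xy Pne sb by blast
  moreover have "dout x + din x + (dout y + din y) \<le> 2 * int a + 1"
    using degree_sum_C_le k_eq_1 ra xy(1) unfolding C by simp
  ultimately show False using b_low sb_low by linarith
qed

end

section \<open>The hamiltonian path\<close>

context strong_bipartite
begin

lemma ex_spanning_gap: "\<exists>\<sigma> b. one_gap \<sigma> b \<and> orbit \<sigma> b = V"
proof -
  obtain \<sigma> b where m: "largest_gap_orbit \<sigma> b" using ex_largest_gap_orbit by blast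
  then have g: "one_gap \<sigma> b" by (simp add: largest_gap_orbit_def)
  have "orbit \<sigma> b = V"
  proof (rule ccontr)
    assume "orbit \<sigma> b \<noteq> V"
    with m interpret nonspanning_gap_orbit E V X a \<sigma> b by unfold_locales
    show False by (rule contradiction)
  qed
  then show ?thesis using g by blast
qed

lemma ex_hamiltonian_list:
  "\<exists>p. p \<noteq> [] \<and> set p = V \<and> distinct p \<and> (\<forall>i. Suc i < length p \<longrightarrow> E (p ! i) (p ! Suc i))"
proof -
  obtain \<sigma> b where g: "one_gap \<sigma> b" and O: "orbit \<sigma> b = V" using ex_spanning_gap by blast
  have self: "b \<in> orbit \<sigma> b" by (rule one_gap_orbit(2)[OF g])
  \<comment> \<open>The path starts right after the gap, so its list of vertices is indexed from \<open>Suc 0\<close>, and \<open>b\<close> comes last.\<close>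
  define n where "n = funpow_dist1 \<sigma> b b"
  define p where "p = map (\<lambda>i. (\<sigma> ^^ Suc i) b) [0..<n]"
  have ret: "(\<sigma> ^^ n) b = b" unfolding n_def by (rule funpow_dist1_prop[OF self])
  have n: "n > 0" by (simp add: n_def)
  have no_b: "(\<sigma> ^^ m) b \<noteq> b" if "0 < m" "m < n" for m
    using funpow_dist1_least[of m \<sigma> b b] that by (simp add: n_def)
  show ?thesis
  proof (intro exI conjI allI impI)
    show "p \<noteq> []" using n by (simp add: p_def)
    have orb: "orbit \<sigma> b = (\<lambda>m. (\<sigma> ^^ m) b) ` {0..<n}"
      using orbit_conv_funpow_dist1[OF self] by (simp add: n_def)
    moreover have "set p = \<sigma> ` (\<lambda>m. (\<sigma> ^^ m) b) ` {0..<n}"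
      by (auto simp: p_def image_image)
    moreover have "\<sigma> ` V = V" using g by (auto simp: one_gap_def swaps_def permutes_image)
    ultimately show setp: "set p = V" using O by simp
    show "distinct p"
    proof (rule card_distinct)
      have "inj_on (\<lambda>m. (\<sigma> ^^ m) b) {0..<n}"
        unfolding n_def by (rule inj_on_funpow_dist1[OF self])
      then have "card V = n" using orb O by (simp add: card_image)
      then show "card (set p) = length p" using setp by (simp add: p_def)
    qed
    fix i assume i: "Suc i < length p"
    have "(\<sigma> ^^ Suc i) b \<noteq> b" using no_b[of "Suc i"] i by (simp add: p_def)
    moreover have "(\<sigma> ^^ Suc i) b \<in> V" using funpow_in_orbit[OF self] O by metis
    ultimately have "E ((\<sigma> ^^ Suc i) b) (\<sigma> ((\<sigma> ^^ Suc i) b))"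
      using g by (simp add: one_gap_def del: funpow.simps)
    then show "E (p ! i) (p ! Suc i)" using i by (simp add: p_def)
  qed
qed

end

section \<open>Digraphs\<close>

lemma (in digraph) out_degree_eq_outdeg:
  "int (out_degree G v) = outdeg (\<lambda>u v. u \<rightarrow>\<^bsub>G\<^esub> v) (verts G) v"
proof -
  have "bij_betw (head G) (out_arcs G v) {w \<in> verts G. v \<rightarrow>\<^bsub>G\<^esub> w}"
    unfolding bij_betw_def
  proof
    show "inj_on (head G) (out_arcs G v)"
      by (intro inj_onI no_multi_arcs) (simp_all add: arc_to_ends_def)
    show "head G ` out_arcs G v = {w \<in> verts G. v \<rightarrow>\<^bsub>G\<^esub> w}"
      by (auto simp: arcs_ends_conv)
  qed
  then have "out_degree G v = card {w \<in> verts G. v \<rightarrow>\<^bsub>G\<^esub> w}"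
    unfolding out_degree_def by (rule bij_betw_same_card)
  then show ?thesis
    using sum_of_bool_mem[OF finite_verts, of "{w \<in> verts G. v \<rightarrow>\<^bsub>G\<^esub> w}"]
    by (simp add: outdeg_def cong: sum.cong_simp)
qed

lemma (in digraph) in_degree_eq_indeg:
  "int (in_degree G v) = indeg (\<lambda>u v. u \<rightarrow>\<^bsub>G\<^esub> v) (verts G) v"
proof -
  have "bij_betw (tail G) (in_arcs G v) {w \<in> verts G. w \<rightarrow>\<^bsub>G\<^esub> v}"
    unfolding bij_betw_def
  proof
    show "inj_on (tail G) (in_arcs G v)"
      by (intro inj_onI no_multi_arcs) (simp_all add: arc_to_ends_def)
    show "tail G ` in_arcs G v = {w \<in> verts G. w \<rightarrow>\<^bsub>G\<^esub> v}"
      by (auto simp: arcs_ends_conv)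
  qed
  then have "in_degree G v = card {w \<in> verts G. w \<rightarrow>\<^bsub>G\<^esub> v}"
    unfolding in_degree_def by (rule bij_betw_same_card)
  then show ?thesis
    using sum_of_bool_mem[OF finite_verts, of "{w \<in> verts G. w \<rightarrow>\<^bsub>G\<^esub> v}"]
    by (simp add: indeg_def cong: sum.cong_simp)
qed

lemma strongly_connected_arc_leaves:
  assumes "strongly_connected D" "wf_digraph D" "S \<subseteq> verts D" "S \<noteq> {}" "S \<noteq> verts D"
  shows "\<exists>u\<in>S. \<exists>v\<in>verts D - S. u \<rightarrow>\<^bsub>D\<^esub> v"
proof (rule ccontr)
  assume closed: "\<not> ?thesis"
  obtain s t where s: "s \<in> S" and t: "t \<in> verts D" "t \<notin> S" using assms(3-5) by blast
  have "s \<rightarrow>\<^sup>*\<^bsub>D\<^esub> t" using assms(1,3) s t by (auto simp: strongly_connected_def)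
  then have "t \<in> S"
    unfolding reachable_def
  proof (induction rule: rtrancl_on_induct)
    case base
    show ?case by (rule s)
  next
    case (step x y)
    then show ?case using closed by blast
  qed
  with t show False by blast
qed

lemma set_vwalk_arcs:
  "set (vwalk_arcs p) = {(p ! i, p ! Suc i) | i. Suc i < length p}"
proof (induction p rule: vwalk_arcs.induct)
  case (3 x y xs)
  have "{((x # y # xs) ! i, (x # y # xs) ! Suc i) | i. Suc i < length (x # y # xs)} =
    insert (x, y) {((y # xs) ! i, (y # xs) ! Suc i) | i. Suc i < length (y # xs)}"
    (is "?L = insert _ ?R")
  proof (intro set_eqI iffI)
    fix q assume "q \<in> ?L"
    then obtain i where "q = ((x # y # xs) ! i, (x # y # xs) ! Suc i)" "Suc i < length (x # y # xs)"
      by blast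
    then show "q \<in> insert (x, y) ?R" by (cases i) auto
  next
    fix q assume "q \<in> insert (x, y) ?R"
    then consider "q = (x, y)" | i where "q = ((y # xs) ! i, (y # xs) ! Suc i)" "Suc i < length (y # xs)"
      by blast
    then show "q \<in> ?L"
    proof cases
      case 1
      then show ?thesis by (intro CollectI exI[of _ 0]) simp
    next
      case 2
      then show ?thesis by (intro CollectI exI[of _ "Suc i"]) simp
    qed
  qed
  then show ?case using 3 by simp
qed auto

theorem theorem3p2:
  fixes D :: "('a, 'b) pre_digraph" and a :: nat
  assumes "digraph D"
    and "strongly_connected D"
    and "balanced_bipartite D"
    and "card (verts D) = 2 * a"
    and "a \<ge> 3"
    and "\<And>u v. nonadjacent D u v \<Longrightarrow> total_degree D u + total_degree D v \<ge> 3 * a - 1"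
  shows "traceable D"
proof -
  interpret digraph D by fact
  obtain X Y where V: "verts D = X \<union> Y" "X \<inter> Y = {}" and "independent_set D X" "independent_set D Y"
    and card: "card X = card Y"
    using assms(3) unfolding balanced_bipartite_def bipartition_def by blast
  then have ind: "\<not> u \<rightarrow>\<^bsub>D\<^esub> v" if "u \<in> X \<and> v \<in> X \<or> u \<in> Y \<and> v \<in> Y" for u v
    using that by (auto simp: independent_set_def)
  have fin: "finite X" "finite Y" using finite_verts V(1) by auto
  have cX: "card X = a" "card Y = a"
    using card_Un_disjoint[OF fin V(2)] assms(4) V(1) card by simp_all
  have Y: "verts D - X = Y" using V by auto
  have deg: "int (total_degree D v) = outdeg (\<lambda>u v. u \<rightarrow>\<^bsub>D\<^esub> v) (verts D) v + indeg (\<lambda>u v. u \<rightarrow>\<^bsub>D\<^esub> v) (verts D) v" for v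
    by (simp add: total_degree_def out_degree_eq_outdeg in_degree_eq_indeg)
  interpret strong_bipartite "\<lambda>u v. u \<rightarrow>\<^bsub>D\<^esub> v" "verts D" X a
  proof
    fix u v assume "u \<rightarrow>\<^bsub>D\<^esub> v"
    then show "u \<in> verts D \<and> v \<in> verts D \<and> (u \<in> X \<longleftrightarrow> v \<notin> X)"
      using ind[of u v] adj_in_verts[of u v] V by blast
  next
    fix S assume "S \<subseteq> verts D" "S \<noteq> {}" "S \<noteq> verts D"
    then show "\<exists>u\<in>S. \<exists>v\<in>verts D - S. u \<rightarrow>\<^bsub>D\<^esub> v"
      by (rule strongly_connected_arc_leaves[OF assms(2) wf_digraph])
  next
    fix u v assume uv: "u \<in> verts D" "v \<in> verts D" "u \<noteq> v" "u \<in> X \<longleftrightarrow> v \<in> X"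
    then have "nonadjacent D u v" using ind[of u v] ind[of v u] V by (auto simp: nonadjacent_def)
    then have "3 * a - 1 \<le> total_degree D u + total_degree D v" by (rule assms(6))
    then have "3 * int a - 1 \<le> int (total_degree D u) + int (total_degree D v)" by linarith
    then show "3 * int a - 1 \<le> outdeg (\<lambda>u v. u \<rightarrow>\<^bsub>D\<^esub> v) (verts D) u + indeg (\<lambda>u v. u \<rightarrow>\<^bsub>D\<^esub> v) (verts D) u
      + (outdeg (\<lambda>u v. u \<rightarrow>\<^bsub>D\<^esub> v) (verts D) v + indeg (\<lambda>u v. u \<rightarrow>\<^bsub>D\<^esub> v) (verts D) v)"
      by (simp only: deg)
  qed (use V cX Y assms(5) in auto)
  obtain p where p: "p \<noteq> []" "set p = verts D" "distinct p"
    "\<And>i. Suc i < length p \<Longrightarrow> p ! i \<rightarrow>\<^bsub>D\<^esub> p ! Suc i"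
    using ex_hamiltonian_list by blast
  have "vpath p D"
    using p by (intro vpathI vwalkI) (auto simp: set_vwalk_arcs)
  with p(2) show ?thesis by (auto simp: traceable_def hamiltonian_path_def)
qed

end
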